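(* In the network model described in the context, each of the procedures $\mathrm{TestOut}(x,j,k)$ and $\mathrm{HP\text{-}TestOut}(x,j,k)$ specified there can be performed with one broadcast-and-echo with message size $O(\log(n+u))$. The echo of $\mathrm{TestOut}$ requires a message of only one bit.
   Context: A communications network is an undirected graph with $n$ nodes. Each node has a unique ID in $\{1,\dots,n^{a}\}$ for a constant $a$. Each edge has an integer weight in $\{1,\dots,u\}$. Each node knows its own ID, the IDs of its neighbors, the weight of each incident edge, and $n$, and has private random bits. Each node may mark its incident edges. The network is properly marked: every edge is marked by both or neither of its endpoints. The marked edges form a forest, and $T_x$ denotes the maximal tree of marked edges containing node $x$. An edge leaving $T_x$ is an (unmarked) edge of the network with exactly one endpoint in $T_x$. Specifications: node $x$ initiates the procedure and receives the output, and $j,k\in\{1,\dots,u\}$. - $\mathrm{TestOut}(x,j,k)$: if there is an edge leaving $T_x$ with weight in the interval $[j,k]$, it returns true with probability at least some absolute positive constant. If there is no such edge it returns false. Thus an output of true is always correct. - $\mathrm{HP\text{-}TestOut}(x,j,k)$: the same, except that if there is an edge leaving $T_x$ with weight in $[j,k]$, it returns true with probability at least $1-n^{-c}$, for any constant $c$ given as a parameter. Broadcast-and-echo: the node $x$ becomes the root of $T=T_x$ and sends a broadcast message to its neighbors in $T$. When a node $v$ receives a broadcast message from its neighbor $y$, it designates $y$ as its parent and sends a broadcast message to each of its other neighbors in $T$ (its children). When a leaf receives a broadcast message, it sends an echo message to its parent, possibly carrying some value. When a non-leaf node has received an echo from every child, it sends an echo to its parent, possibly aggregating its own value with its children's values.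 The broadcast-and-echo is done when the root has received echoes from all its children. The message size is the number of bits of each broadcast or echo message. *)

theory Defs
  imports "HOL-Probability.Probability"
begin

text \<open>
  Nodes are identified with their IDs. The graph is simple: an edge is a two-element set of
  nodes. \<open>marks N v\<close> is the set of edges marked by the node \<open>v\<close>.
\<close>

record network =
  nodes :: "nat set"
  edges :: "nat set set"
  weight :: "nat set \<Rightarrow> nat"
  marks :: "nat \<Rightarrow> nat set set"

definition marked_edges :: "network \<Rightarrow> nat set set" where
  "marked_edges N = (\<Union>v\<in>nodes N. marks N v)"

definition forest :: "nat set set \<Rightarrow> bool" where
  "forest F \<longleftrightarrow> \<not> (\<exists>p. 3 \<le> length p \<and> distinct p \<and>
     (\<forall>i<length p. {p ! i, p ! (Suc i mod length p)} \<in> F))"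

definition properly_marked :: "network \<Rightarrow> bool" where
  "properly_marked N \<longleftrightarrow>
     (\<forall>v\<in>nodes N. marks N v \<subseteq> {e \<in> edges N. v \<in> e}) \<and>
     (\<forall>e\<in>edges N. (\<forall>v\<in>e. e \<in> marks N v) \<or> (\<forall>v\<in>e. e \<notin> marks N v))"

definition valid_network :: "real \<Rightarrow> nat \<Rightarrow> network \<Rightarrow> bool" where
  "valid_network a u N \<longleftrightarrow>
     finite (nodes N) \<and>
     (\<forall>v\<in>nodes N. 1 \<le> v \<and> real v \<le> real (card (nodes N)) powr a) \<and>
     (\<forall>e\<in>edges N. e \<subseteq> nodes N \<and> card e = 2) \<and>
     (\<forall>e\<in>edges N. weight N e \<in> {1..u}) \<and>
     properly_marked N \<and>
     forest (marked_edges N)"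

definition tree :: "network \<Rightarrow> nat \<Rightarrow> nat set" where
  "tree N x = {y. (x, y) \<in> {(v, w). {v, w} \<in> marked_edges N}\<^sup>*}"

definition leaving_edges :: "network \<Rightarrow> nat \<Rightarrow> nat set set" where
  "leaving_edges N x = {e \<in> edges N - marked_edges N. card (e \<inter> tree N x) = 1}"

text \<open>
  \<open>incident\<close> maps each neighbour's ID to the weight of the connecting edge; \<open>tree_nbrs\<close> contains
  the neighbours across edges the node itself has marked. The weight bound \<open>u\<close> is not part of a
  node's knowledge.
\<close>

record view =
  own_id :: nat
  num_nodes :: nat
  incident :: "nat \<rightharpoonup> nat"
  tree_nbrs :: "nat set"

definition view_of :: "network \<Rightarrow> nat \<Rightarrow> view" where
  "view_of N v =
     \<lparr> own_id = v,
       num_nodes = card (nodes N),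
       incident = (\<lambda>w. if {v, w} \<in> edges N then Some (weight N {v, w}) else None),
       tree_nbrs = {w. {v, w} \<in> marks N v} \<rparr>"

type_synonym coins = "nat \<Rightarrow> bool"

definition coin_space :: "network \<Rightarrow> (nat \<Rightarrow> coins) measure" where
  "coin_space N =
     (\<Pi>\<^sub>M v\<in>nodes N. \<Pi>\<^sub>M i\<in>(UNIV :: nat set). measure_pmf (bernoulli_pmf (1/2)))"

type_synonym msg = "bool list"

text \<open>
  A procedure consists of the local computations of the nodes. The input is the pair \<open>(j, k)\<close>,
  known to the initiator only.

    \<^item> \<open>bcast_fn\<close>: the message the root broadcasts,
      from its view, its random bits and the input.
    \<^item> \<open>echo_fn\<close>: the echo of a non-root node, from its view, its random bits, its parent, the
      broadcast message, and the echoes of its children (the domain of the map).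
    \<^item> \<open>output_fn\<close>: the output at the root, from its view, its random bits, the input and the
      echoes of its children.

  A node sees no part of the network other than its \<^typ>\<open>view\<close>, so a procedure is uniform in
  the network.
\<close>

record procedure =
  bcast_fn :: "view \<Rightarrow> coins \<Rightarrow> nat \<times> nat \<Rightarrow> msg"
  echo_fn :: "view \<Rightarrow> coins \<Rightarrow> nat \<Rightarrow> msg \<Rightarrow> (nat \<rightharpoonup> msg) \<Rightarrow> msg"
  output_fn :: "view \<Rightarrow> coins \<Rightarrow> nat \<times> nat \<Rightarrow> (nat \<rightharpoonup> msg) \<Rightarrow> bool"

text \<open>
  The two predicates below hold of the messages sent (sender, receiver, content) when \<open>x\<close>
  initiates the procedure with input \<open>jk\<close> and the outcome of the random bits is \<open>\<omega>\<close>. As a node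
  waits for all its children before it acts on their echoes, these messages do not depend on
  the order of delivery. The broadcast message is forwarded unchanged. The parent of \<open>v\<close> is
  the node \<open>y\<close> it got the broadcast from; a leaf is the case \<open>dom E = {}\<close> of \<open>echo_sent\<close>.
\<close>

inductive bcast_sent ::
  "network \<Rightarrow> procedure \<Rightarrow> nat \<Rightarrow> nat \<times> nat \<Rightarrow> (nat \<Rightarrow> coins) \<Rightarrow> nat \<Rightarrow> nat \<Rightarrow> msg \<Rightarrow> bool"
  for N P x jk \<omega> where
  root: "z \<in> tree_nbrs (view_of N x) \<Longrightarrow>
    bcast_sent N P x jk \<omega> x z (bcast_fn P (view_of N x) (\<omega> x) jk)"
| forward: "\<lbrakk>bcast_sent N P x jk \<omega> y v m; z \<in> tree_nbrs (view_of N v) - {y}\<rbrakk> \<Longrightarrow>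
    bcast_sent N P x jk \<omega> v z m"

inductive echo_sent ::
  "network \<Rightarrow> procedure \<Rightarrow> nat \<Rightarrow> nat \<times> nat \<Rightarrow> (nat \<Rightarrow> coins) \<Rightarrow> nat \<Rightarrow> nat \<Rightarrow> msg \<Rightarrow> bool"
  for N P x jk \<omega> where
  "\<lbrakk>bcast_sent N P x jk \<omega> y v m;
    dom E = tree_nbrs (view_of N v) - {y};
    \<forall>z e. E z = Some e \<longrightarrow> echo_sent N P x jk \<omega> z v e\<rbrakk> \<Longrightarrow>
    echo_sent N P x jk \<omega> v y (echo_fn P (view_of N v) (\<omega> v) y m E)"

text \<open>The broadcast-and-echo is done, and the root outputs \<open>b\<close>.\<close>

definition returns ::
  "network \<Rightarrow> procedure \<Rightarrow> nat \<Rightarrow> nat \<times> nat \<Rightarrow> (nat \<Rightarrow> coins) \<Rightarrow> bool \<Rightarrow> bool" where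
  "returns N P x jk \<omega> b \<longleftrightarrow>
     (\<exists>E. dom E = tree_nbrs (view_of N x) \<and>
          (\<forall>z e. E z = Some e \<longrightarrow> echo_sent N P x jk \<omega> z x e) \<and>
          b = output_fn P (view_of N x) (\<omega> x) jk E)"

text \<open>
  TestOut and HP-TestOut differ only in the success probability \<open>q\<close>. The first conjunct says
  that in every execution the broadcast-and-echo gets done, with a unique output. If the event
  in the last conjunct were not measurable, its \<^const>\<open>measure\<close> would be \<open>0\<close>, so for
  \<open>q > 0\<close> measurability is part of the requirement.
\<close>

definition performs_test_out ::
  "real \<Rightarrow> procedure \<Rightarrow> network \<Rightarrow> nat \<Rightarrow> nat \<Rightarrow> nat \<Rightarrow> bool" where
  "performs_test_out q P N x j k \<longleftrightarrow>
     (\<forall>\<omega>\<in>space (coin_space N). \<exists>!b. returns N P x (j, k) \<omega> b) \<and>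
     ((\<forall>e\<in>leaving_edges N x. weight N e \<notin> {j..k}) \<longrightarrow>
        (\<forall>\<omega>\<in>space (coin_space N). returns N P x (j, k) \<omega> False)) \<and>
     ((\<exists>e\<in>leaving_edges N x. weight N e \<in> {j..k}) \<longrightarrow>
        measure (coin_space N) {\<omega> \<in> space (coin_space N). returns N P x (j, k) \<omega> True} \<ge> q)"

definition message_size_le ::
  "real \<Rightarrow> procedure \<Rightarrow> network \<Rightarrow> nat \<Rightarrow> nat \<Rightarrow> nat \<Rightarrow> bool" where
  "message_size_le B P N x j k \<longleftrightarrow>
     (\<forall>\<omega>\<in>space (coin_space N). \<forall>v w m.
        bcast_sent N P x (j, k) \<omega> v w m \<or> echo_sent N P x (j, k) \<omega> v w m \<longrightarrow>
        real (length m) \<le> B)"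

definition one_bit_echo :: "procedure \<Rightarrow> network \<Rightarrow> nat \<Rightarrow> nat \<Rightarrow> nat \<Rightarrow> bool" where
  "one_bit_echo P N x j k \<longleftrightarrow>
     (\<forall>\<omega>\<in>space (coin_space N). \<forall>v w m.
        echo_sent N P x (j, k) \<omega> v w m \<longrightarrow> length m = 1)"

end

theory Submission
  imports "HOL-Algebra.Algebraic_Closure_Type" "HOL-Library.Z2" Defs
begin

text \<open>
  Let \<open>K\<close> be the field with \<open>2 ^ m\<close> elements, where \<open>m = O(log n)\<close>, and give every edge a
  code \<open>i(e)\<close>, computable by both endpoints, that is polynomially bounded in \<open>n\<close>. The root
  broadcasts \<open>j\<close>, \<open>k\<close> and a random \<open>r \<in> K\<close>. Every node adds up \<open>r ^ i(e)\<close> over its incident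
  edges \<open>e\<close> with weight in \<open>[j, k]\<close>, and the echoes add these values up over the tree. In
  characteristic 2 the edges with both endpoints in the tree cancel, and the root is left with
  \<open>p(r)\<close> for the polynomial \<open>p\<close> with one monomial of degree \<open>i(e)\<close> for each leaving edge \<open>e\<close>
  with weight in \<open>[j, k]\<close>. If there is no such edge, then \<open>p(r) = 0\<close>. Otherwise \<open>p\<close> has at most
  \<open>deg p\<close> roots, so \<open>p(r) \<noteq> 0\<close> with high probability once \<open>2 ^ m\<close> is a large enough power of
  \<open>n\<close>. This is HP-TestOut.

  For TestOut the root also broadcasts a random \<open>b \<in> K\<close>, and the values \<open>r ^ i(e)\<close> are replaced
  by their images under the additive map \<open>x \<mapsto> Tr (b * x)\<close> to \<open>{0, 1}\<close>, which fit into one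
  bit. The trace is a polynomial of degree \<open>2 ^ (m - 1)\<close>, so \<open>Tr (b * p(r)) = 1\<close> for at least
  half of all \<open>b\<close> if \<open>p(r) \<noteq> 0\<close>.
\<close>

section \<open>Finite fields inside an algebraic closure\<close>

lemma order_le_1_if_pderiv_nonzero:
  fixes p :: "'a::field poly"
  assumes "poly (pderiv p) x \<noteq> 0"
  shows "order x p \<le> 1"
proof (rule ccontr)
  assume "\<not> order x p \<le> 1"
  hence "[:-x, 1:] ^ 2 dvd p"
    by (intro dvd_trans[OF le_imp_power_dvd order_1]) simp
  then obtain q where "p = [:-x, 1:] ^ 2 * q" by (elim dvdE)
  hence "p = [:-x, 1:] * ([:-x, 1:] * q)" by (simp only: power2_eq_square mult.assoc)
  hence "poly (pderiv p) x = 0" by (simp add: pderiv_mult del: mult_pCons_left)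
  with assms show False by simp
qed

text \<open>Over an algebraically closed field the root multiset has as many elements as the degree.
  The nonvanishing derivative forces every multiplicity to be 1, so the multiset is a set.\<close>

lemma card_roots_separable:
  fixes p :: "'a::alg_closed_field poly"
  assumes "p \<noteq> 0" and sep: "\<And>x. poly (pderiv p) x \<noteq> 0"
  shows "card {x. poly p x = 0} = degree p"
proof -
  obtain A where A: "size A = degree p" "p = smult (lead_coeff p) (\<Prod>x\<in>#A. [:-x, 1:])"
    using alg_closed_imp_factorization[OF assms(1)] by blast
  have "proots (\<Prod>x\<in>#A. [:-x, 1:]) = A"
    by (induction A) (simp_all add: proots_mult prod_mset_zero_iff image_iff del: mult_pCons_left)
  hence roots: "proots p = A"
    using assms(1) by (subst A(2)) simp
  have "card {x. poly p x = 0} = (\<Sum>x\<in>set_mset (proots p). 1)"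
    using assms(1) by simp
  also have "\<dots> = (\<Sum>x\<in>set_mset (proots p). count (proots p) x)"
  proof (rule sum.cong)
    fix x assume "x \<in># proots p"
    hence "count (proots p) x > 0" by (simp only: count_greater_zero_iff)
    moreover have "count (proots p) x \<le> 1"
      using order_le_1_if_pderiv_nonzero[OF sep] assms(1) by simp
    ultimately show "1 = count (proots p) x" by linarith
  qed simp
  also have "\<dots> = degree p"
    by (simp add: roots A(1) flip: size_multiset_overloaded_eq)
  finally show ?thesis .
qed

text \<open>In an algebraically closed field of prime characteristic \<open>p\<close> and for
  \<open>m > 0\<close> this is the subfield with \<open>p ^ m\<close> elements, obtained as a subset
  of the closure rather than as a type depending on \<open>m\<close>.\<close>

definition frobenius_fixed :: "nat \<Rightarrow> 'a::field set" where
  "frobenius_fixed m = {x. x ^ (CHAR('a) ^ m) = x}"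

text \<open>The elements are the roots of \<open>x ^ q - x\<close> with
  \<open>q = CHAR('a) ^ m\<close>. Its derivative is the constant -1, because \<open>q\<close>
  vanishes in the field, so all \<open>q\<close> roots are distinct.\<close>

lemma card_frobenius_fixed:
  assumes "prime CHAR('a::alg_closed_field)" "m > 0"
  shows "card (frobenius_fixed m :: 'a set) = CHAR('a) ^ m"
proof -
  let ?q = "CHAR('a) ^ m"
  define p :: "'a poly" where "p = monom 1 ?q - monom 1 1"
  have q: "?q > 1" using assms prime_gt_1_nat one_less_power by blast
  have q0: "(of_nat ?q :: 'a) = 0" using assms by (simp add: of_nat_eq_0_iff_char_dvd)
  have deg: "degree p = ?q"
    unfolding p_def diff_conv_add_uminus using q
    by (subst degree_add_eq_left) (auto simp: degree_monom_eq)
  hence "p \<noteq> 0" using q by (metis degree_0 not_one_less_zero)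
  moreover have "pderiv p = [:-1:]"
    unfolding p_def pderiv_diff pderiv_monom q0 by (simp add: monom_0)
  ultimately have "card {x. poly p x = 0} = ?q"
    using card_roots_separable[of p] deg by simp
  moreover have "{x. poly p x = 0} = frobenius_fixed m"
    by (auto simp: p_def frobenius_fixed_def poly_monom)
  ultimately show ?thesis by simp
qed

lemma frobenius_fixed_0 [simp]: "prime CHAR('a) \<Longrightarrow> (0::'a::field) \<in> frobenius_fixed m"
  by (auto simp: frobenius_fixed_def power_0_left dest: prime_gt_0_nat)

lemma frobenius_fixed_add:
  "prime CHAR('a) \<Longrightarrow> (x::'a::field) \<in> frobenius_fixed m \<Longrightarrow> y \<in> frobenius_fixed m
    \<Longrightarrow> x + y \<in> frobenius_fixed m"
  by (simp add: frobenius_fixed_def freshmans_dream'[OF _ refl])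

lemma frobenius_fixed_mult:
  "x \<in> frobenius_fixed m \<Longrightarrow> y \<in> frobenius_fixed m \<Longrightarrow> x * y \<in> frobenius_fixed m"
  by (simp add: frobenius_fixed_def power_mult_distrib)

lemma frobenius_fixed_power: "x \<in> frobenius_fixed m \<Longrightarrow> x ^ k \<in> frobenius_fixed m"
  by (simp add: frobenius_fixed_def flip: power_mult) (metis mult.commute power_mult)

section \<open>The trace and root counting\<close>

definition trace_poly :: "nat \<Rightarrow> 'a::field poly" where
  "trace_poly m = (\<Sum>i<m. monom 1 (2 ^ i))"

text \<open>On the field with \<open>2 ^ m\<close> elements this is the absolute trace. Its form as
  a polynomial value lets the degree bound its zeros.\<close>

definition field_trace :: "nat \<Rightarrow> 'a::field \<Rightarrow> 'a" where
  "field_trace m x = poly (trace_poly m) x"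

lemma field_trace_eq: "field_trace m x = (\<Sum>i<m. x ^ (2 ^ i))"
  by (simp add: field_trace_def trace_poly_def poly_sum poly_monom)

lemma field_trace_add:
  "CHAR('a) = 2 \<Longrightarrow> field_trace m (x + y :: 'a::field) = field_trace m x + field_trace m y"
  unfolding field_trace_eq sum.distrib[symmetric]
  by (intro sum.cong refl freshmans_dream'[where 'a='a]) auto

lemma field_trace_0 [simp]: "field_trace m 0 = 0"
  by (simp add: field_trace_eq power_0_left)

lemma field_trace_sum:
  "CHAR('a) = 2 \<Longrightarrow> field_trace m (\<Sum>i\<in>I. f i :: 'a::field) = (\<Sum>i\<in>I. field_trace m (f i))"
  by (induction I rule: infinite_finite_induct) (auto simp: field_trace_add)

text \<open>Squaring shifts the summands \<open>x ^ (2 ^ i)\<close> cyclically, since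
  \<open>x ^ (2 ^ m) = x\<close>. So the trace equals its own square, which leaves only 0 and
  1.\<close>

lemma field_trace_01:
  assumes "CHAR('a::field) = 2" "(x::'a) \<in> frobenius_fixed m"
  shows "field_trace m x \<in> {0, 1}"
proof -
  have "field_trace m x ^ 2 = (\<Sum>i<m. (x ^ (2 ^ i)) ^ 2)"
    unfolding field_trace_eq by (rule freshmans_dream_sum) (simp_all add: assms(1))
  also have "\<dots> = (\<Sum>i<m. x ^ (2 ^ Suc i))"
    by (simp only: power_Suc2 power_mult)
  also have "\<dots> = (\<Sum>i=1..<Suc m. x ^ (2 ^ i))"
    by (simp only: lessThan_atLeast0 One_nat_def sum.shift_bounds_Suc_ivl)
  also have "\<dots> = field_trace m x"
  proof (cases m)
    case (Suc k)
    have "(\<Sum>i=1..<Suc m. x ^ (2 ^ i)) = (\<Sum>i=1..<m. x ^ (2 ^ i)) + x ^ (2 ^ m)"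
      using Suc by simp
    also have "x ^ (2 ^ m) = x ^ (2 ^ 0)" using assms by (simp add: frobenius_fixed_def)
    also have "(\<Sum>i=1..<m. x ^ (2 ^ i)) + x ^ (2 ^ 0) = field_trace m x"
      using Suc by (simp add: field_trace_eq lessThan_atLeast0 sum.atLeast_Suc_lessThan)
    finally show ?thesis .
  qed (simp add: field_trace_eq)
  finally have "field_trace m x * (field_trace m x - 1) = 0" by (simp add: power2_eq_square algebra_simps)
  thus ?thesis by auto
qed

lemma degree_trace_poly: "m > 0 \<Longrightarrow> degree (trace_poly m :: 'a::field poly) = 2 ^ (m - 1)"
proof (induction m)
  case (Suc m)
  show ?case
  proof (cases "m = 0")
    case False
    hence "degree (trace_poly m :: 'a poly) < 2 ^ m" using Suc.IH by simp
    thus ?thesis by (simp add: trace_poly_def degree_add_eq_right degree_monom_eq)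
  qed (simp add: trace_poly_def degree_monom_eq)
qed simp

text \<open>Division by \<open>c\<close> carries the roots of the trace polynomial to the solutions
  \<open>b\<close>. The bound counts solutions in the whole field \<open>'a\<close>, and hence also
  those in any finite subfield; it is half of \<open>2 ^ m\<close>.\<close>

lemma card_field_trace_zero_le:
  assumes "m > 0" "c \<noteq> (0::'a::field)"
  shows "card {b. field_trace m (b * c) = 0} \<le> 2 ^ (m - 1)" "finite {b. field_trace m (b * c) = 0}"
proof -
  let ?p = "trace_poly m :: 'a poly"
  have deg: "degree ?p > 0" using degree_trace_poly[OF assms(1), where 'a='a] by simp
  hence fin: "finite {x. field_trace m x = (0::'a)}" unfolding field_trace_def by (intro poly_roots_finite) auto
  have eq: "{b. field_trace m (b * c) = 0} = (\<lambda>x. x / c) ` {x. field_trace m x = 0}"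
    using assms(2) by (force simp: image_iff intro: exI[of _ "_ * c"])
  show "finite {b. field_trace m (b * c) = 0}" unfolding eq using fin by simp
  have "card {b. field_trace m (b * c) = 0} \<le> card {x. field_trace m x = (0::'a)}"
    unfolding eq by (rule card_image_le[OF fin])
  also have "\<dots> \<le> degree ?p" unfolding field_trace_def using deg by (intro card_poly_roots_bound) auto
  finally show "card {b. field_trace m (b * c) = 0} \<le> 2 ^ (m - 1)"
    using degree_trace_poly[OF assms(1), where 'a='a] by simp
qed

text \<open>The exponents are distinct, so the corresponding polynomial has coefficients 0 and 1
  with no cancellation, even in characteristic 2. It is nonzero of degree below
  \<open>D\<close>.\<close>

lemma card_sum_powers_zero:
  fixes I :: "nat set"
  assumes "finite I" "I \<noteq> {}" "\<And>i. i \<in> I \<Longrightarrow> i < D"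
  shows "card {x::'a::field. (\<Sum>i\<in>I. x ^ i) = 0} < D"
    "finite {x::'a::field. (\<Sum>i\<in>I. x ^ i) = 0}"
proof -
  define p :: "'a poly" where "p = (\<Sum>i\<in>I. monom 1 i)"
  have c: "coeff p i = (if i \<in> I then 1 else 0)" for i
    using assms(1) by (simp add: p_def coeff_sum)
  have p0: "p \<noteq> 0" using assms(2) c by (metis coeff_0 ex_in_conv zero_neq_one)
  have "D > 0" using assms by fastforce
  hence "degree p < D" using c assms(3)
    by (intro degree_lessI) (auto simp: p0 not_less[symmetric])
  moreover have eq: "{x. (\<Sum>i\<in>I. x ^ i) = 0} = {x. poly p x = 0}"
    by (simp add: p_def poly_sum poly_monom)
  ultimately show "card {x::'a. (\<Sum>i\<in>I. x ^ i) = 0} < D"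
    using card_poly_roots_bound[OF p0] by simp
  show "finite {x::'a. (\<Sum>i\<in>I. x ^ i) = 0}" unfolding eq by (rule poly_roots_finite[OF p0])
qed

lemma CHAR_bit: "CHAR(bit) = 2"
  by (rule CHAR_eq_posI) (auto simp: numeral_2_eq_2 less_Suc_eq)

section \<open>Broadcast-and-echo in a marked forest\<close>

text \<open>If \<open>y\<close> is the parent of \<open>v\<close> in a tree, then \<open>reach F y v\<close> is the subtree below \<open>v\<close>.\<close>

definition reach :: "'a set set \<Rightarrow> 'a \<Rightarrow> 'a \<Rightarrow> 'a set" where
  "reach F y v = {w. (v, w) \<in> {(a, b). {a, b} \<in> F \<and> b \<noteq> y}\<^sup>*}"

lemma reach_refl [simp]: "v \<in> reach F y v"
  by (simp add: reach_def)

lemma reach_step: "w \<in> reach F y v \<Longrightarrow> {w, w'} \<in> F \<Longrightarrow> w' \<noteq> y \<Longrightarrow> w' \<in> reach F y v"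
  unfolding reach_def by (simp add: rtrancl.rtrancl_into_rtrancl)

lemma reach_induct [consumes 1, case_names refl step]:
  assumes "w \<in> reach F y v" "Q v"
    "\<And>w w'. w \<in> reach F y v \<Longrightarrow> Q w \<Longrightarrow> {w, w'} \<in> F \<Longrightarrow> w' \<noteq> y \<Longrightarrow> Q w'"
  shows "Q w"
proof -
  have "(v, w) \<in> {(a, b). {a, b} \<in> F \<and> b \<noteq> y}\<^sup>*" using assms(1) by (simp add: reach_def)
  thus ?thesis
    by (induction rule: rtrancl_induct) (use assms(2,3) in \<open>auto simp: reach_def\<close>)
qed

lemma not_in_reach: "v \<noteq> y \<Longrightarrow> y \<notin> reach F y v"
  using reach_induct[of y F y v "\<lambda>w. w \<noteq> y"] by blast

lemma reach_subset: "F \<subseteq> Pow V \<Longrightarrow> reach F y v \<subseteq> insert v V"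
  using reach_induct[of _ F y v "\<lambda>w. w \<in> insert v V"] by blast

text \<open>When a new first vertex already occurs on the path, the path is cut down to the suffix
  starting there.\<close>

lemma rtrancl_imp_distinct_path:
  assumes "(a, b) \<in> r\<^sup>*"
  shows "\<exists>p. p \<noteq> [] \<and> hd p = a \<and> last p = b \<and> distinct p \<and>
    successively (\<lambda>x y. (x, y) \<in> r) p \<and> set p \<subseteq> {w. (a, w) \<in> r\<^sup>*}"
  using assms
proof (induction rule: converse_rtrancl_induct)
  case base
  show ?case by (intro exI[of _ "[b]"]) auto
next
  case (step a c)
  then obtain p where p: "p \<noteq> []" "hd p = c" "last p = b" "distinct p"
    "successively (\<lambda>x y. (x, y) \<in> r) p" "set p \<subseteq> {w. (c, w) \<in> r\<^sup>*}" by blast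
  have sub: "set p \<subseteq> {w. (a, w) \<in> r\<^sup>*}" using p(6) step.hyps(1)
    by (auto intro: converse_rtrancl_into_rtrancl)
  show ?case
  proof (cases "a \<in> set p")
    case True
    then obtain xs ys where "p = xs @ a # ys" by (auto simp: in_set_conv_decomp)
    thus ?thesis using p sub by (intro exI[of _ "a # ys"]) (auto simp: successively_append_iff)
  next
    case False
    thus ?thesis using p sub step.hyps(1)
      by (intro exI[of _ "a # p"]) (auto simp: successively_Cons)
  qed
qed

text \<open>A path from \<open>z\<close> to \<open>z'\<close> that avoids \<open>v\<close> would
  close up through \<open>v\<close> to a cycle with at least three vertices.\<close>

lemma forest_no_detour:
  assumes "forest F" "{v, z} \<in> F" "{v, z'} \<in> F" "z \<noteq> z'" "z \<noteq> v"
  shows "z' \<notin> reach F v z"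
proof
  assume "z' \<in> reach F v z"
  then obtain p where p: "p \<noteq> []" "hd p = z" "last p = z'" "distinct p"
    "successively (\<lambda>x y. {x, y} \<in> F \<and> y \<noteq> v) p" "set p \<subseteq> reach F v z"
    using rtrancl_imp_distinct_path[of z z' "{(a, b). {a, b} \<in> F \<and> b \<noteq> v}"]
    by (auto simp: reach_def)
  let ?q = "v # p"
  have "v \<notin> set p" using p(6) not_in_reach[OF assms(5)] by blast
  moreover have "length p \<ge> 2"
    using p(1-3) assms(4) by (cases p; cases "tl p") auto
  moreover have "{?q ! i, ?q ! (Suc i mod length ?q)} \<in> F" if "i < length ?q" for i
  proof (cases i)
    case 0
    thus ?thesis using p(1,2) assms(2) by (simp add: hd_conv_nth)
  next
    case (Suc l)
    show ?thesis
    proof (cases "Suc l = length p")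
      case True
      \<comment> \<open>The index wraps around here: the closing edge of the cycle leads from
        \<open>z'\<close> back to \<open>v\<close>.\<close>
      hence "p ! l = z'" using p(1,3) by (metis last_conv_nth diff_Suc_1)
      hence "?q ! i = z'" by (simp only: Suc nth_Cons_Suc)
      moreover have "Suc i mod length ?q = 0" using Suc True by simp
      ultimately show ?thesis using assms(3) by (simp add: insert_commute)
    next
      case False
      hence "Suc l < length p" using that Suc by simp
      thus ?thesis using p(5) Suc by (simp add: successively_conv_nth)
    qed
  qed
  ultimately show False
    using assms(1) p(4) unfolding forest_def
    by (metis distinct.simps(2) length_Cons numeral_3_eq_3 numeral_2_eq_2 Suc_le_mono)
qed

locale marked_forest =
  fixes F :: "nat set set"
  assumes forest: "forest F" and card_2: "e \<in> F \<Longrightarrow> card e = 2"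
begin

lemma no_loop: "{v, z} \<in> F \<Longrightarrow> z \<noteq> v"
  using card_2 by fastforce

text \<open>The disjunction covers a real parent \<open>y\<close> as well as a fictitious one
  outside the forest, which serves for the root. A path below \<open>z\<close> cannot meet a real
  parent \<open>y\<close>, for that would be a detour between two neighbours of
  \<open>v\<close>.\<close>

lemma reach_child_subset:
  assumes "{y, v} \<in> F \<or> y \<notin> \<Union>F" "{v, z} \<in> F" "z \<noteq> y"
  shows "reach F v z \<subseteq> reach F y v"
proof
  fix w assume "w \<in> reach F v z"
  thus "w \<in> reach F y v"
  proof (induction rule: reach_induct)
    case refl
    show ?case using assms reach_step[of v F y v z] by simp
  next
    case (step w w')
    have "w' \<noteq> y"
    proof
      assume "w' = y"
      moreover have "w' \<in> reach F v z" using step reach_step by metis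
      moreover have "y \<in> \<Union>F" using step \<open>w' = y\<close> by blast
      ultimately show False
        using forest_no_detour[OF forest assms(2), of y] assms no_loop[OF assms(2)]
        by (auto simp: insert_commute)
    qed
    thus ?case using step reach_step by metis
  qed
qed

text \<open>Along a path from \<open>v\<close>, a step out of \<open>v\<close> enters the subtree of
  a child, and any other step stays in that subtree or returns to \<open>v\<close>.\<close>

lemma reach_decomp:
  assumes "{y, v} \<in> F \<or> y \<notin> \<Union>F" "v \<noteq> y"
  shows "reach F y v = insert v (\<Union>z\<in>{z. {v, z} \<in> F} - {y}. reach F v z)" (is "_ = ?R")
proof
  show "?R \<subseteq> reach F y v" using reach_child_subset[OF assms(1)] by auto
  show "reach F y v \<subseteq> ?R"
  proof
    fix w assume "w \<in> reach F y v"
    thus "w \<in> ?R"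
    proof (induction rule: reach_induct)
      case (step w w')
      show ?case
      proof (cases "w = v \<or> w' = v")
        case True
        thus ?thesis using step reach_refl[of w' F v] by blast
      next
        case False
        then obtain z where "z \<in> {z. {v, z} \<in> F} - {y}" "w \<in> reach F v z" using step.IH by blast
        thus ?thesis using reach_step[of w F v z w'] step False by blast
      qed
    qed simp
  qed
qed

lemma reach_children_disjoint:
  assumes "{v, z} \<in> F" "{v, z'} \<in> F" "z \<noteq> z'"
  shows "reach F v z \<inter> reach F v z' = {}"
proof (rule ccontr)
  assume "reach F v z \<inter> reach F v z' \<noteq> {}"
  then obtain w where w: "w \<in> reach F v z" "w \<in> reach F v z'" by blast
  \<comment> \<open>Excluding \<open>v\<close> at both ends makes the relation symmetric, so the
    path from \<open>z'\<close> to \<open>w\<close> can be reversed and appended to the one from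
    \<open>z\<close> to \<open>w\<close>.\<close>
  let ?r = "{(a, b). {a, b} \<in> F \<and> a \<noteq> v \<and> b \<noteq> v}"
  have path: "(t, w) \<in> ?r\<^sup>*" if "w \<in> reach F v t" "t \<noteq> v" for t
    using that(1)
  proof (induction rule: reach_induct)
    case (step w w')
    have "w \<noteq> v" using step(1) not_in_reach[OF that(2)] by metis
    thus ?case using step by (auto intro: rtrancl_into_rtrancl)
  qed simp
  have "(z, w) \<in> ?r\<^sup>*" "(z', w) \<in> ?r\<^sup>*" using path w assms no_loop by blast+
  moreover have "sym ?r" by (auto simp: sym_def insert_commute)
  ultimately have "(z, z') \<in> ?r\<^sup>*" by (meson sym_rtrancl symD rtrancl_trans)
  hence "z' \<in> reach F v z"
    unfolding reach_def by (auto elim: rtrancl_mono[THEN subsetD, rotated])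
  thus False using forest_no_detour[OF forest assms] no_loop[OF assms(1)] by blast
qed

text \<open>This is the recursion that the echoes carry out: a node adds its own value to the totals
  of its children's subtrees.\<close>

lemma sum_reach:
  fixes g :: "nat \<Rightarrow> 'k::comm_monoid_add"
  assumes "{y, v} \<in> F \<or> y \<notin> \<Union>F" "v \<noteq> y" "finite (reach F y v)"
  shows "sum g (reach F y v) = g v + (\<Sum>z\<in>{z. {v, z} \<in> F} - {y}. sum g (reach F v z))"
proof -
  let ?C = "{z. {v, z} \<in> F} - {y}"
  have "?C \<subseteq> reach F y v" using reach_decomp[OF assms(1,2)] by auto
  hence C: "finite ?C" using assms(3) finite_subset by blast
  have fin: "finite (reach F v z)" if "z \<in> ?C" for z
    using reach_child_subset[OF assms(1)] that assms(3) finite_subset by blast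
  have "v \<notin> reach F v z" if "z \<in> ?C" for z
    using not_in_reach[of z v] no_loop that by blast
  hence "sum g (reach F y v) = g v + sum g (\<Union>z\<in>?C. reach F v z)"
    unfolding reach_decomp[OF assms(1,2)] using C fin by (subst sum.insert) auto
  also have "sum g (\<Union>z\<in>?C. reach F v z) = (\<Sum>z\<in>?C. sum g (reach F v z))"
    using C fin reach_children_disjoint by (intro sum.UNION_disjoint) auto
  finally show ?thesis .
qed

text \<open>Subtree size is the measure for the induction over echoes.\<close>

lemma card_reach_child:
  assumes "{y, v} \<in> F" "{v, z} \<in> F" "z \<noteq> y" "finite (reach F y v)"
  shows "card (reach F v z) < card (reach F y v)"
proof (rule psubset_card_mono[OF assms(4)])
  have "v \<notin> reach F v z" using not_in_reach no_loop[OF assms(2)] by metis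
  thus "reach F v z \<subset> reach F y v"
    using reach_child_subset[of y v z] assms by auto
qed

end

section \<open>Marked trees in valid networks\<close>

lemma valid_networkD:
  assumes "valid_network a u N"
  shows valid_finite_nodes: "finite (nodes N)"
    and valid_node_ge_1: "\<And>v. v \<in> nodes N \<Longrightarrow> 1 \<le> v"
    and valid_node_le: "\<And>v. v \<in> nodes N \<Longrightarrow> real v \<le> real (card (nodes N)) powr a"
    and valid_edge_subset: "\<And>e. e \<in> edges N \<Longrightarrow> e \<subseteq> nodes N"
    and valid_card_edge: "\<And>e. e \<in> edges N \<Longrightarrow> card e = 2"
    and valid_marked_edges: "marked_edges N \<subseteq> edges N"
  using assms unfolding valid_network_def properly_marked_def marked_edges_def by blast+

lemma valid_marked_forest: "valid_network a u N \<Longrightarrow> marked_forest (marked_edges N)"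
  by (meson marked_forest.intro subsetD valid_card_edge valid_marked_edges valid_network_def)

text \<open>Proper marking lets a node recognise its tree edges from its own marks alone.\<close>

lemma tree_nbrs_eq:
  assumes "valid_network a u N" "v \<in> nodes N"
  shows "tree_nbrs (view_of N v) = {w. {v, w} \<in> marked_edges N}"
proof -
  have "properly_marked N" using assms(1) by (simp add: valid_network_def)
  thus ?thesis using assms(2) unfolding view_of_def marked_edges_def properly_marked_def
    by auto
qed

lemma finite_reach_marked:
  assumes "valid_network a u N"
  shows "finite (reach (marked_edges N) y v)"
  by (rule finite_subset[OF reach_subset[of _ "nodes N"]])
    (use assms valid_marked_edges valid_edge_subset valid_finite_nodes in blast)+

text \<open>
  IDs start at \<open>1\<close>, so \<open>0\<close> is not a node and can play the parent of the root.
\<close>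

lemma zero_not_in_marked:
  assumes "valid_network a u N"
  shows "0 \<notin> \<Union>(marked_edges N)"
proof
  assume "0 \<in> \<Union>(marked_edges N)"
  hence "0 \<in> nodes N" using valid_marked_edges[OF assms] valid_edge_subset[OF assms] by blast
  thus False using valid_node_ge_1[OF assms] by fastforce
qed

lemma tree_eq_reach:
  assumes "valid_network a u N"
  shows "tree N x = reach (marked_edges N) 0 x"
proof -
  have "w \<noteq> 0" if "{v, w} \<in> marked_edges N" for v w
  proof
    assume "w = 0"
    with that have "0 \<in> \<Union>(marked_edges N)" by (intro UnionI[of "{v, w}"]) simp_all
    with zero_not_in_marked[OF assms] show False by contradiction
  qed
  hence "{(v, w). {v, w} \<in> marked_edges N} = {(v, w). {v, w} \<in> marked_edges N \<and> w \<noteq> 0}"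
    by blast
  thus ?thesis by (simp only: tree_def reach_def)
qed

section \<open>Aggregating node values by echoes\<close>

lemma bcast_sentD:
  assumes "valid_network a u N" "x \<in> nodes N" "bcast_sent N P x jk \<omega> y v m"
  shows "m = bcast_fn P (view_of N x) (\<omega> x) jk" "{y, v} \<in> marked_edges N"
  using assms(3)
proof (induction rule: bcast_sent.induct)
  case (root z) {
    case 1 show ?case by simp
  next
    case 2 show ?case using root tree_nbrs_eq[OF assms(1,2)] by simp
  }
next
  case (forward y v m z) {
    case 1 show ?case using forward by simp
  next
    case 2
    have "v \<in> nodes N"
      using forward.IH(2) valid_marked_edges[OF assms(1)] valid_edge_subset[OF assms(1)] by blast
    thus ?case using forward.hyps(2) tree_nbrs_eq[OF assms(1)] by simp
  }
qed

text \<open>A single execution whose echoes encode sums of the node values \<open>g\<close>. The set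
  \<open>A\<close> contains all these sums, so the echo function has to handle only children's
  values from \<open>A\<close>, where decoding is possible.\<close>

locale aggregation =
  fixes a :: real and u N x and P :: procedure and jk \<omega>
    and g :: "nat \<Rightarrow> 'k::comm_monoid_add" and A :: "'k set"
    and enc :: "'k \<Rightarrow> msg"
  assumes valid: "valid_network a u N" and x: "x \<in> nodes N"
    and A_0: "0 \<in> A" and A_add: "\<And>b c. b \<in> A \<Longrightarrow> c \<in> A \<Longrightarrow> b + c \<in> A"
    and g_A: "\<And>v. v \<in> nodes N \<Longrightarrow> g v \<in> A"
    and echo_fn: "\<And>v y E s. v \<in> nodes N \<Longrightarrow>
      (\<And>z. z \<in> dom E \<Longrightarrow> s z \<in> A \<and> E z = Some (enc (s z))) \<Longrightarrow>
      echo_fn P (view_of N v) (\<omega> v) y (bcast_fn P (view_of N x) (\<omega> x) jk) E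
        = enc (g v + (\<Sum>z\<in>dom E. s z))"
begin

abbreviation "F \<equiv> marked_edges N"

sublocale marked_forest F
  using valid by (rule valid_marked_forest)

lemma marked_in_nodes: "{v, w} \<in> F \<Longrightarrow> v \<in> nodes N \<and> w \<in> nodes N"
  using valid_marked_edges[OF valid] valid_edge_subset[OF valid] by blast

lemma sum_in_A: "S \<subseteq> nodes N \<Longrightarrow> sum g S \<in> A"
  by (induction S rule: infinite_finite_induct) (auto simp: A_0 A_add g_A)

lemma reach_nodes: "v \<in> nodes N \<Longrightarrow> reach F y v \<subseteq> nodes N"
  using reach_subset[of F "nodes N" y v] valid_marked_edges[OF valid] valid_edge_subset[OF valid] by blast

text \<open>Induction on subtree size, with \<open>sum_reach\<close> for the step. The equivalence
  gives both that an echo is sent and that its content is unique.\<close>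

lemma echo_sent_iff:
  assumes "bcast_sent N P x jk \<omega> y v m"
  shows "echo_sent N P x jk \<omega> v y e \<longleftrightarrow> e = enc (sum g (reach F y v))"
  using assms
proof (induction "card (reach F y v)" arbitrary: y v m e rule: less_induct)
  case less
  let ?M = "bcast_fn P (view_of N x) (\<omega> x) jk"
  have M: "m = ?M" and yv: "{y, v} \<in> F" using bcast_sentD[OF valid x less.prems] by auto
  have v: "v \<in> nodes N" using marked_in_nodes[OF yv] by simp
  have nbrs: "tree_nbrs (view_of N v) = {w. {v, w} \<in> F}" by (rule tree_nbrs_eq[OF valid v])
  let ?C = "{z. {v, z} \<in> F} - {y}"
  let ?s = "\<lambda>z. sum g (reach F v z)"
  have child: "echo_sent N P x jk \<omega> z v e' \<longleftrightarrow> e' = enc (?s z)" if "z \<in> ?C" for z e'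
  proof (rule less.hyps)
    show "card (reach F v z) < card (reach F y v)"
      using card_reach_child[OF yv] that finite_reach_marked[OF valid] by blast
    show "bcast_sent N P x jk \<omega> v z m"
      using bcast_sent.forward[OF less.prems] that nbrs by blast
  qed
  have fn: "echo_fn P (view_of N v) (\<omega> v) y ?M E = enc (sum g (reach F y v))"
    if "dom E = ?C" "\<forall>z e. E z = Some e \<longrightarrow> echo_sent N P x jk \<omega> z v e" for E
  proof -
    have "E z = Some (enc (?s z))" if "z \<in> dom E" for z
      using that child \<open>dom E = ?C\<close> \<open>\<forall>z e. _ z e\<close> by (metis domD)
    moreover have "?s z \<in> A" if "z \<in> dom E" for z
      using that \<open>dom E = ?C\<close> marked_in_nodes by (intro sum_in_A reach_nodes) blast
    ultimately have "echo_fn P (view_of N v) (\<omega> v) y ?M E = enc (g v + (\<Sum>z\<in>?C. ?s z))"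
      using echo_fn[OF v, of E ?s] \<open>dom E = ?C\<close> by simp
    thus ?thesis
      using sum_reach[of y v g] yv no_loop[OF yv] finite_reach_marked[OF valid] by simp
  qed
  show ?case
  proof
    assume "echo_sent N P x jk \<omega> v y e"
    then obtain m' E where *: "bcast_sent N P x jk \<omega> y v m'" "dom E = tree_nbrs (view_of N v) - {y}"
      "\<forall>z e. E z = Some e \<longrightarrow> echo_sent N P x jk \<omega> z v e"
      "e = echo_fn P (view_of N v) (\<omega> v) y m' E"
      by (cases rule: echo_sent.cases) blast
    have "m' = ?M" using bcast_sentD[OF valid x *(1)] by simp
    thus "e = enc (sum g (reach F y v))" using fn[of E] * nbrs by simp
  next
    assume e: "e = enc (sum g (reach F y v))"
    define E where "E z = (if z \<in> ?C then Some (enc (?s z)) else None)" for z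
    have dom: "dom E = ?C" by (auto simp: E_def split: if_splits)
    have ch: "\<forall>z e. E z = Some e \<longrightarrow> echo_sent N P x jk \<omega> z v e"
      using child by (auto simp: E_def)
    show "echo_sent N P x jk \<omega> v y e"
      using echo_sent.intros[OF less.prems, of E] dom ch fn[OF dom ch] nbrs M e by simp
  qed
qed

lemma echo_sentD:
  assumes "echo_sent N P x jk \<omega> v y e"
  shows "\<exists>b\<in>A. e = enc b"
proof -
  obtain m where m: "bcast_sent N P x jk \<omega> y v m" using assms by (cases rule: echo_sent.cases) blast
  hence "v \<in> nodes N" using bcast_sentD[OF valid x m] marked_in_nodes by blast
  thus ?thesis using echo_sent_iff[OF m] assms sum_in_A reach_nodes by blast
qed

lemma returns_iff:
  assumes out: "\<And>E s. (\<And>z. z \<in> dom E \<Longrightarrow> s z \<in> A \<and> E z = Some (enc (s z))) \<Longrightarrow>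
      output_fn P (view_of N x) (\<omega> x) jk E = R (g x + (\<Sum>z\<in>dom E. s z))"
  shows "returns N P x jk \<omega> b \<longleftrightarrow> b = R (sum g (tree N x))"
proof -
  let ?C = "{z. {x, z} \<in> F}"
  let ?s = "\<lambda>z. sum g (reach F x z)"
  have nbrs: "tree_nbrs (view_of N x) = ?C" by (rule tree_nbrs_eq[OF valid x])
  have child: "echo_sent N P x jk \<omega> z x e' \<longleftrightarrow> e' = enc (?s z)" if "z \<in> ?C" for z e'
    using echo_sent_iff[OF bcast_sent.root] that nbrs by blast
  \<comment> \<open>The root is treated as a node with parent 0, so all its tree neighbours count as
    children.\<close>
  have "?C - {0} = ?C" using zero_not_in_marked[OF valid] by blast
  hence total: "sum g (tree N x) = g x + (\<Sum>z\<in>?C. ?s z)"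
    using sum_reach[of 0 x g] zero_not_in_marked[OF valid] valid_node_ge_1[OF valid x]
      finite_reach_marked[OF valid] by (simp add: tree_eq_reach[OF valid])
  have fn: "output_fn P (view_of N x) (\<omega> x) jk E = R (sum g (tree N x))"
    if "dom E = ?C" "\<forall>z e. E z = Some e \<longrightarrow> echo_sent N P x jk \<omega> z x e" for E
  proof -
    have "E z = Some (enc (?s z))" if "z \<in> dom E" for z
      using that child \<open>dom E = ?C\<close> \<open>\<forall>z e. _ z e\<close> by (metis domD)
    moreover have "?s z \<in> A" if "z \<in> dom E" for z
      using that \<open>dom E = ?C\<close> marked_in_nodes by (intro sum_in_A reach_nodes) blast
    ultimately show ?thesis using out[of E ?s] \<open>dom E = ?C\<close> total by simp
  qed
  define E where "E z = (if z \<in> ?C then Some (enc (?s z)) else None)" for z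
  have dom: "dom E = ?C" by (auto simp: E_def split: if_splits)
  have ch: "\<forall>z e. E z = Some e \<longrightarrow> echo_sent N P x jk \<omega> z x e"
    using child by (auto simp: E_def)
  show ?thesis unfolding returns_def nbrs using fn dom ch by metis
qed

end

section \<open>Cancellation of inner edges\<close>

text \<open>Exchanging the sums counts each edge once per endpoint in \<open>T\<close>. Edges
  counted twice vanish in characteristic 2, and those counted once remain.\<close>

lemma sum_incident_edges_char_2:
  fixes h :: "'a set \<Rightarrow> 'k::ring_1"
  assumes "CHAR('k) = 2" "finite T" "finite E" "\<And>e. e \<in> E \<Longrightarrow> card e = 2"
  shows "(\<Sum>v\<in>T. \<Sum>w | {v, w} \<in> E. h {v, w}) = (\<Sum>e\<in>{e \<in> E. card (e \<inter> T) = 1}. h e)"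
proof -
  have "(\<Sum>w | {v, w} \<in> E. h {v, w}) = (\<Sum>e\<in>E. if v \<in> e then h e else 0)" for v
  proof -
    have "(\<Sum>w | {v, w} \<in> E. h {v, w}) = (\<Sum>e\<in>{e \<in> E. v \<in> e}. h e)"
    proof (rule sum.reindex_bij_betw[where h = "\<lambda>w. {v, w}"])
      have "e \<in> (\<lambda>w. {v, w}) ` {w. {v, w} \<in> E}" if "e \<in> E" "v \<in> e" for e
        using assms(4)[OF that(1)] that by (auto simp: card_2_iff insert_commute)
      thus "bij_betw (\<lambda>w. {v, w}) {w. {v, w} \<in> E} {e \<in> E. v \<in> e}"
        by (auto simp: bij_betw_def inj_on_def doubleton_eq_iff)
    qed
    thus ?thesis using assms(3) by (simp add: sum.inter_filter)
  qed
  hence "(\<Sum>v\<in>T. \<Sum>w | {v, w} \<in> E. h {v, w}) = (\<Sum>e\<in>E. \<Sum>v\<in>T. if v \<in> e then h e else 0)"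
    by (simp add: sum.swap[of _ T E])
  also have "\<dots> = (\<Sum>e\<in>E. of_nat (card (e \<inter> T)) * h e)"
    using assms(2) by (intro sum.cong refl) (simp add: sum.If_cases Int_commute)
  also have "\<dots> = (\<Sum>e\<in>E. if card (e \<inter> T) = 1 then h e else 0)"
  proof (rule sum.cong[OF refl])
    fix e assume "e \<in> E"
    hence "card e = 2" "finite e" using assms(4) card_ge_0_finite[of e] by auto
    hence "card (e \<inter> T) \<le> 2" by (metis card_mono inf_le1)
    moreover have "(of_nat 2 :: 'k) = 0" by (metis assms(1) of_nat_CHAR)
    ultimately show "of_nat (card (e \<inter> T)) * h e = (if card (e \<inter> T) = 1 then h e else 0)"
      by (auto simp: numeral_2_eq_2 le_Suc_eq)
  qed
  also have "\<dots> = (\<Sum>e\<in>{e \<in> E. card (e \<inter> T) = 1}. h e)"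
    using assms(3) by (simp add: sum.inter_filter)
  finally show ?thesis .
qed

text \<open>A marked edge with one endpoint in the tree has the other endpoint there too, so edges
  with exactly one endpoint in the tree are automatically unmarked.\<close>

lemma leaving_edges_eq:
  assumes "valid_network a u N"
  shows "leaving_edges N x = {e \<in> edges N. card (e \<inter> tree N x) = 1}"
proof -
  have "card (e \<inter> tree N x) \<noteq> 1" if "e \<in> marked_edges N" for e
  proof
    assume "card (e \<inter> tree N x) = 1"
    then obtain v where v: "e \<inter> tree N x = {v}" by (auto simp: card_1_singleton_iff)
    have "card e = 2" using that valid_marked_edges[OF assms] valid_card_edge[OF assms] by blast
    moreover have "v \<in> e" using v by blast
    ultimately have "card (e - {v}) = 1" by simp
    then obtain w where "e - {v} = {w}" by (rule card_1_singletonE)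
    hence w: "e = {v, w}" "w \<noteq> v" using \<open>v \<in> e\<close> by blast+
    have "v \<in> tree N x" using v by blast
    hence "w \<in> tree N x" using that w unfolding tree_def
      by (auto intro: rtrancl_into_rtrancl)
    thus False using v w by blast
  qed
  thus ?thesis unfolding leaving_edges_def by blast
qed

section \<open>Random seeds\<close>

text \<open>The event is a finite disjoint union of cylinders, one for each good prefix, and each
  cylinder has probability \<open>1 / 2 ^ s\<close>.\<close>

lemma measure_coin_prefix:
  "measure (\<Pi>\<^sub>M i\<in>(UNIV :: nat set). measure_pmf (bernoulli_pmf (1/2))) {c. Q (map c [0..<s])}
    = card {xs. length xs = s \<and> Q xs} / 2 ^ s"
  "{c. Q (map c [0..<s])} \<in> sets (\<Pi>\<^sub>M i\<in>(UNIV :: nat set). measure_pmf (bernoulli_pmf (1/2)))"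
proof -
  let ?M = "\<lambda>_::nat. measure_pmf (bernoulli_pmf (1/2))"
  let ?P = "\<Pi>\<^sub>M i\<in>UNIV. ?M i"
  interpret product_prob_space ?M "UNIV :: nat set" by unfold_locales
  let ?C = "\<lambda>xs. {c. map c [0..<s] = xs}"
  let ?G = "{xs. length xs = s \<and> Q xs}"
  have C_eq: "?C xs = {c \<in> space ?P. \<forall>i\<in>{..<s}. c i \<in> {xs ! i}}" if "length xs = s" for xs
    using that by (auto simp: space_PiM list_eq_iff_nth_eq)
  have C_sets: "?C xs \<in> sets ?P" if "length xs = s" for xs
    unfolding C_eq[OF that] by (intro sets.sets_Collect_finite_All sets_Collect_single') auto
  have C_prob: "measure ?P (?C xs) = 1 / 2 ^ s" if "length xs = s" for xs
  proof -
    have "emeasure ?P (?C xs) = (\<Prod>i<s. emeasure (?M i) {xs ! i})"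
      unfolding C_eq[OF that] by (rule emeasure_PiM_Collect) auto
    also have "\<dots> = ennreal (\<Prod>i<s. 1 / 2)"
      by (subst prod_ennreal[symmetric]) (auto simp: emeasure_pmf_single split: bool.split intro!: prod.cong)
    finally show ?thesis by (simp add: measure_def power_one_over)
  qed
  have "finite ?G" using finite_lists_length_eq[of "UNIV :: bool set" s] by (rule rev_finite_subset) auto
  have U: "{c. Q (map c [0..<s])} = (\<Union>xs\<in>?G. ?C xs)" by auto
  show "{c. Q (map c [0..<s])} \<in> sets ?P"
    unfolding U using \<open>finite ?G\<close> C_sets by (intro sets.finite_UN) auto
  have "measure ?P (\<Union>xs\<in>?G. ?C xs) = (\<Sum>xs\<in>?G. measure ?P (?C xs))"
    using \<open>finite ?G\<close> C_sets by (intro finite_measure_finite_Union) (auto simp: disjoint_family_on_def)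
  thus "measure ?P {c. Q (map c [0..<s])} = card ?G / 2 ^ s"
    unfolding U by (simp add: C_prob)
qed

lemma measure_coin_space_prefix:
  assumes "x \<in> nodes N"
  shows "measure (coin_space N) {\<omega> \<in> space (coin_space N). Q (map (\<omega> x) [0..<s])}
    = card {xs. length xs = s \<and> Q xs} / 2 ^ s"
proof -
  let ?P = "\<Pi>\<^sub>M i\<in>(UNIV :: nat set). measure_pmf (bernoulli_pmf (1/2))"
  interpret prob_space ?P by (intro prob_space_PiM) unfold_locales
  interpret product_prob_space "\<lambda>_::nat. ?P" "nodes N" by unfold_locales
  have "emeasure (coin_space N) {\<omega> \<in> space (coin_space N). \<omega> x \<in> {c. Q (map c [0..<s])}}
      = emeasure ?P {c. Q (map c [0..<s])}"
    unfolding coin_space_def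
    by (rule emeasure_PiM_Collect_single[OF assms measure_coin_prefix(2)])
  thus ?thesis by (simp add: measure_def flip: measure_coin_prefix(1))
qed

section \<open>Linear sketches of the leaving edges\<close>

fun bin :: "nat \<Rightarrow> bool list" where
  "bin n = (if n = 0 then [] else odd n # bin (n div 2))"

declare bin.simps [simp del]

primrec unbin :: "bool list \<Rightarrow> nat" where
  "unbin [] = 0"
| "unbin (b # bs) = of_bool b + 2 * unbin bs"

lemma unbin_bin [simp]: "unbin (bin n) = n"
  by (induction n rule: bin.induct) (subst bin.simps, auto)

lemma length_bin_le: "n < 2 ^ l \<Longrightarrow> length (bin n) \<le> l"
proof (induction l arbitrary: n)
  case (Suc l)
  have "n div 2 < 2 ^ l" using Suc.prems by simp
  from Suc.IH[OF this] show ?case by (subst bin.simps) simp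
qed (simp add: bin.simps)

text \<open>The smaller and the larger ID are the two digits in base \<open>B\<close>. Being
  symmetric in the endpoints, the code is the same when computed from either side.\<close>

definition edge_code :: "nat \<Rightarrow> nat set \<Rightarrow> nat" where
  "edge_code B e = Min e + B * Max e"

lemma Min_Max_less:
  assumes "e \<subseteq> {..<B :: nat}" "card e = 2"
  shows "Min e < B" "Max e < B"
proof -
  have "finite e" "e \<noteq> {}" using assms(2) card_ge_0_finite[of e] by auto
  thus "Min e < B" "Max e < B" using assms(1) Min_in[of e] Max_in[of e] by blast+
qed

lemma edge_code_less:
  assumes "e \<subseteq> {..<B}" "card e = 2"
  shows "edge_code B e < B ^ 2"
proof -
  have "edge_code B e < B + B * Max e" using Min_Max_less[OF assms] by (simp add: edge_code_def)
  also have "\<dots> = B * Suc (Max e)" by simp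
  also have "\<dots> \<le> B * B" using Min_Max_less[OF assms] by (intro mult_le_mono2) simp
  finally show ?thesis by (simp add: power2_eq_square)
qed

lemma inj_on_edge_code: "inj_on (edge_code B) {e. e \<subseteq> {..<B} \<and> card e = 2}"
proof (rule inj_onI)
  have Min_Max: "e = {Min e, Max e}" if "card e = 2" for e :: "nat set"
  proof -
    obtain p q where "e = {p, q}" using \<open>card e = 2\<close> by (auto simp: card_2_iff)
    thus ?thesis by (cases "p \<le> q") (auto simp: max_def min_def)
  qed
  fix e e' assume *: "e \<in> {e. e \<subseteq> {..<B} \<and> card e = 2}" "e' \<in> {e. e \<subseteq> {..<B} \<and> card e = 2}"
    "edge_code B e = edge_code B e'"
  have "Min e < B" "Min e' < B"
    using * Min_Max_less(1) by auto
  hence "Min e = edge_code B e mod B" "Max e = edge_code B e div B"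
    "Min e' = edge_code B e' mod B" "Max e' = edge_code B e' div B"
    by (simp_all add: edge_code_def)
  thus "e = e'" using * Min_Max[of e] Min_Max[of e'] by simp
qed

section \<open>The generic procedure and its correctness\<close>

text \<open>All parameters depend on the number \<open>n\<close> of nodes, which every node knows:
  the ID bound \<open>B\<close>, the seed length \<open>s\<close>, the value \<open>h\<close> of an
  edge code under a seed, and the range \<open>A\<close> of sums with its encoding. HP-TestOut and
  TestOut are two instances.\<close>

locale linear_sketch =
  fixes B s :: "nat \<Rightarrow> nat" and h :: "nat \<Rightarrow> bool list \<Rightarrow> nat \<Rightarrow> 'k::ring_1"
    and A :: "nat \<Rightarrow> 'k set" and enc :: "nat \<Rightarrow> 'k \<Rightarrow> msg" and dec :: "nat \<Rightarrow> msg \<Rightarrow> 'k"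
  assumes char_2: "CHAR('k) = 2"
    and A_0: "0 \<in> A n" and A_add: "\<And>b c. b \<in> A n \<Longrightarrow> c \<in> A n \<Longrightarrow> b + c \<in> A n"
    and h_A: "\<And>xs i. length xs = s n \<Longrightarrow> h n xs i \<in> A n"
    and dec_enc: "\<And>b. b \<in> A n \<Longrightarrow> dec n (enc n b) = b"
begin

definition node_sum :: "view \<Rightarrow> bool list \<Rightarrow> nat \<times> nat \<Rightarrow> 'k" where
  "node_sum V xs jk = (\<Sum>w | \<exists>c\<in>{fst jk..snd jk}. incident V w = Some c.
     h (num_nodes V) xs (edge_code (B (num_nodes V)) {own_id V, w}))"

text \<open>
  All nodes know the number of nodes, hence the length of the random seed. So the seed and the
  code of \<open>(j, k)\<close> can be concatenated without a separator.
\<close>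

definition sketch_proc :: procedure where
  "sketch_proc =
    \<lparr> bcast_fn = (\<lambda>V c jk. map c [0..<s (num_nodes V)] @ bin (prod_encode jk)),
      echo_fn = (\<lambda>V c y m E. enc (num_nodes V)
        (node_sum V (take (s (num_nodes V)) m) (prod_decode (unbin (drop (s (num_nodes V)) m)))
          + (\<Sum>z\<in>dom E. dec (num_nodes V) (the (E z))))),
      output_fn = (\<lambda>V c jk E. node_sum V (map c [0..<s (num_nodes V)]) jk
          + (\<Sum>z\<in>dom E. dec (num_nodes V) (the (E z))) \<noteq> 0) \<rparr>"

lemma node_sum_in_A:
  assumes "length xs = s (num_nodes V)"
  shows "node_sum V xs jk \<in> A (num_nodes V)"
proof -
  have "(\<Sum>w\<in>W. h (num_nodes V) xs (f w)) \<in> A (num_nodes V)" for f and W :: "nat set"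
    by (induction W rule: infinite_finite_induct) (auto simp: A_0 A_add h_A assms)
  thus ?thesis unfolding node_sum_def .
qed

lemma node_sum_view_of:
  "node_sum (view_of N v) xs (j, k) =
    (\<Sum>w | {v, w} \<in> {e \<in> edges N. weight N e \<in> {j..k}}.
      h (card (nodes N)) xs (edge_code (B (card (nodes N))) {v, w}))"
  unfolding node_sum_def view_of_def by (auto intro!: sum.cong split: if_splits)

context
  fixes a :: real and u N x and j k :: nat and \<omega> :: "nat \<Rightarrow> coins"
  assumes valid: "valid_network a u N" and x: "x \<in> nodes N"
begin

lemma num_nodes_view_of: "num_nodes (view_of N v) = card (nodes N)"
  by (simp add: view_of_def)

lemma aggregation:
  "aggregation a u N x sketch_proc (j, k) \<omega>
    (\<lambda>v. node_sum (view_of N v) (map (\<omega> x) [0..<s (card (nodes N))]) (j, k))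
    (A (card (nodes N))) (enc (card (nodes N)))"
proof (unfold_locales, goal_cases)
  \<comment> \<open>This is the assumption on \<open>echo_fn\<close>. Cutting the broadcast at the
    seed length recovers the seed and \<open>(j, k)\<close>, and \<open>dec\<close> recovers the
    children's sums.\<close>
  case (6 v y E f)
  thus ?case
    by (simp add: sketch_proc_def num_nodes_view_of dec_enc)
qed (use valid x A_0 A_add node_sum_in_A[of _ "view_of N _"] in \<open>auto simp: num_nodes_view_of\<close>)

lemma sum_node_sums:
  "(\<Sum>v\<in>tree N x. node_sum (view_of N v) (map (\<omega> x) [0..<s (card (nodes N))]) (j, k)) =
    (\<Sum>e\<in>{e \<in> leaving_edges N x. weight N e \<in> {j..k}}.
      h (card (nodes N)) (map (\<omega> x) [0..<s (card (nodes N))]) (edge_code (B (card (nodes N))) e))"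
proof -
  have "edges N \<subseteq> Pow (nodes N)" using valid_edge_subset[OF valid] by blast
  hence "finite (edges N)" using valid_finite_nodes[OF valid] finite_subset by blast
  moreover have "finite (tree N x)"
    unfolding tree_eq_reach[OF valid] by (rule finite_reach_marked[OF valid])
  ultimately have "(\<Sum>v\<in>tree N x. node_sum (view_of N v) (map (\<omega> x) [0..<s (card (nodes N))]) (j, k)) =
    (\<Sum>e\<in>{e \<in> {e \<in> edges N. weight N e \<in> {j..k}}. card (e \<inter> tree N x) = 1}.
      h (card (nodes N)) (map (\<omega> x) [0..<s (card (nodes N))]) (edge_code (B (card (nodes N))) e))"
    unfolding node_sum_view_of
    by (intro sum_incident_edges_char_2[OF char_2]) (auto simp: valid_card_edge[OF valid])
  also have "{e \<in> {e \<in> edges N. weight N e \<in> {j..k}}. card (e \<inter> tree N x) = 1} =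
    {e \<in> leaving_edges N x. weight N e \<in> {j..k}}"
    unfolding leaving_edges_eq[OF valid] by blast
  finally show ?thesis .
qed

lemma returns_sketch_proc:
  "returns N sketch_proc x (j, k) \<omega> b \<longleftrightarrow>
    b = ((\<Sum>e\<in>{e \<in> leaving_edges N x. weight N e \<in> {j..k}}.
      h (card (nodes N)) (map (\<omega> x) [0..<s (card (nodes N))]) (edge_code (B (card (nodes N))) e)) \<noteq> 0)"
proof -
  interpret aggregation a u N x sketch_proc "(j, k)" \<omega>
    "\<lambda>v. node_sum (view_of N v) (map (\<omega> x) [0..<s (card (nodes N))]) (j, k)"
    "A (card (nodes N))" "enc (card (nodes N))"
    by (rule aggregation)
  show ?thesis unfolding sum_node_sums[symmetric]
    by (rule returns_iff[where R = "\<lambda>t. t \<noteq> 0"])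
      (simp add: sketch_proc_def num_nodes_view_of dec_enc)
qed

lemma length_bcast:
  "bcast_sent N sketch_proc x (j, k) \<omega> v w m \<Longrightarrow>
    length m = s (card (nodes N)) + length (bin (prod_encode (j, k)))"
  by (drule bcast_sentD(1)[OF valid x]) (simp add: sketch_proc_def num_nodes_view_of)

lemma echo_in_range:
  "echo_sent N sketch_proc x (j, k) \<omega> v w m \<Longrightarrow> m \<in> enc (card (nodes N)) ` A (card (nodes N))"
  using aggregation.echo_sentD[OF aggregation] by blast

end

text \<open>Injectivity of the edge codes turns the sum over leaving edges into a sum over a set
  \<open>I\<close> of codes. Success then means counting the root's seeds for which this sum is
  nonzero; an empty sum gives the output false with certainty.\<close>

lemma performs_test_out_sketch_proc:
  assumes valid: "valid_network a u N" and x: "x \<in> nodes N" and ids: "nodes N \<subseteq> {..<B (card (nodes N))}"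
    and prob: "\<And>I. finite I \<Longrightarrow> I \<noteq> {} \<Longrightarrow> I \<subseteq> {..<B (card (nodes N)) ^ 2} \<Longrightarrow>
      q \<le> card {xs. length xs = s (card (nodes N)) \<and> (\<Sum>i\<in>I. h (card (nodes N)) xs i) \<noteq> 0}
        / 2 ^ s (card (nodes N))"
  shows "performs_test_out q sketch_proc N x j k"
proof -
  let ?n = "card (nodes N)"
  let ?S = "{e \<in> leaving_edges N x. weight N e \<in> {j..k}}"
  let ?I = "edge_code (B ?n) ` ?S"
  note ret = returns_sketch_proc[OF valid x]
  have S: "?S \<subseteq> {e. e \<subseteq> {..<B ?n} \<and> card e = 2}"
    using valid_edge_subset[OF valid] valid_card_edge[OF valid] ids
    by (auto simp: leaving_edges_def)
  have "finite ?S"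
    by (rule finite_subset[OF S]) (auto intro: finite_subset[OF _ finite_Pow_iff[THEN iffD2, of "{..<B ?n}"]])
  have sum_I: "(\<Sum>e\<in>?S. h ?n xs (edge_code (B ?n) e)) = (\<Sum>i\<in>?I. h ?n xs i)" for xs
    by (rule sum.reindex_cong[OF inj_on_subset[OF inj_on_edge_code S], symmetric]) auto
  have "measure (coin_space N) {\<omega> \<in> space (coin_space N). returns N sketch_proc x (j, k) \<omega> True} \<ge> q"
    if "\<exists>e\<in>leaving_edges N x. weight N e \<in> {j..k}"
  proof -
    have "?I \<noteq> {}" using that by blast
    moreover have "?I \<subseteq> {..<B ?n ^ 2}" using S edge_code_less by auto
    ultimately show ?thesis
      using prob[of ?I] \<open>finite ?S\<close>
        measure_coin_space_prefix[OF x, of "\<lambda>xs. (\<Sum>i\<in>?I. h ?n xs i) \<noteq> 0" "s ?n"]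
      unfolding ret sum_I by simp
  qed
  moreover have "returns N sketch_proc x (j, k) \<omega> False" if "\<forall>e\<in>leaving_edges N x. weight N e \<notin> {j..k}" for \<omega>
  proof -
    have "?S = {}" using that by blast
    show ?thesis unfolding ret \<open>?S = {}\<close> by simp
  qed
  moreover have "\<exists>!b. returns N sketch_proc x (j, k) \<omega> b" for \<omega>
    unfolding ret by blast
  ultimately show ?thesis unfolding performs_test_out_def by blast
qed

end

section \<open>Finite-field sketches\<close>

lemma CHAR_closure: "CHAR(bit alg_closure) = 2"
  by (simp add: CHAR_bit)

text \<open>For \<open>m = 0\<close> there is no such bijection: the condition \<open>x ^ 1 = x\<close> holds everywhere.\<close>

definition field_elem :: "nat \<Rightarrow> bool list \<Rightarrow> bit alg_closure" where
  "field_elem m = (SOME f. bij_betw f {xs. length xs = m} (frobenius_fixed m))"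

lemma card_bool_lists: "card {xs :: bool list. length xs = m} = 2 ^ m"
  using card_lists_length_eq[of "UNIV :: bool set" m] by simp

lemma finite_bool_lists: "finite {xs :: bool list. length xs = m}"
  using finite_lists_length_eq[of "UNIV :: bool set" m] by simp

lemma bij_betw_field_elem:
  assumes "m > 0"
  shows "bij_betw (field_elem m) {xs. length xs = m} (frobenius_fixed m)"
proof -
  have card: "card (frobenius_fixed m :: bit alg_closure set) = 2 ^ m"
    using card_frobenius_fixed[where 'a = "bit alg_closure", OF _ assms] by (simp add: CHAR_bit)
  hence "finite (frobenius_fixed m :: bit alg_closure set)" by (intro card_ge_0_finite) simp
  hence "\<exists>f. bij_betw f {xs :: bool list. length xs = m} (frobenius_fixed m :: bit alg_closure set)"
    using card by (intro finite_same_card_bij finite_bool_lists) (simp_all add: card_bool_lists)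
  thus ?thesis unfolding field_elem_def by (rule someI_ex)
qed

text \<open>Bit strings of length \<open>m\<close> stand for distinct field elements, so at most
  \<open>D\<close> of them are zeros of \<open>p\<close>, even when zeros are counted in the whole
  closure.\<close>

lemma card_field_elem_neq_0_ge:
  assumes "m > 0" and fin: "finite {x. p x = (0 :: bit alg_closure)}" and D: "card {x. p x = 0} \<le> D"
  shows "2 ^ m - D \<le> card {xs. length xs = m \<and> p (field_elem m xs) \<noteq> 0}"
proof -
  let ?L = "{xs :: bool list. length xs = m}" and ?Z = "{xs. length xs = m \<and> p (field_elem m xs) = 0}"
  have "inj_on (field_elem m) ?Z"
    by (rule inj_on_subset[OF bij_betw_imp_inj_on[OF bij_betw_field_elem[OF assms(1)]]]) auto
  hence "card ?Z \<le> card {x. p x = 0}" by (rule card_inj_on_le) (use fin in auto)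
  moreover have "card (?L - ?Z) = card ?L - card ?Z"
    by (rule card_Diff_subset[OF finite_subset[OF _ finite_bool_lists[of m]]]) auto
  moreover have "?L - ?Z = {xs. length xs = m \<and> p (field_elem m xs) \<noteq> 0}" by auto
  ultimately show ?thesis using D by (simp add: card_bool_lists)
qed

lemma power_sketch_hits:
  assumes "m > 0" "finite I" "I \<noteq> {}" "I \<subseteq> {..<D}"
  shows "1 - D / 2 ^ m \<le> card {xs. length xs = m \<and> (\<Sum>i\<in>I. field_elem m xs ^ i) \<noteq> 0} / 2 ^ m"
proof -
  note roots = card_sum_powers_zero[OF assms(2,3), of D, where 'a = "bit alg_closure"]
  have "2 ^ m - D \<le> card {xs. length xs = m \<and> (\<Sum>i\<in>I. field_elem m xs ^ i) \<noteq> 0}"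
    using card_field_elem_neq_0_ge[OF assms(1), of "\<lambda>x. \<Sum>i\<in>I. x ^ i" D] roots assms(4)
    by fastforce
  \<comment> \<open>Truncated subtraction on the naturals is never below the real
    difference.\<close>
  hence "real (2 ^ m) - real D \<le> real (card {xs. length xs = m \<and> (\<Sum>i\<in>I. field_elem m xs ^ i) \<noteq> 0})"
    by linarith
  thus ?thesis by (simp add: field_simps)
qed

text \<open>The first half of the seed is the evaluation point, the second half the multiplier
  inside the trace. At least half of the points give a nonzero value, and for each of these at least
  half of the multipliers give a nonzero trace, whence 1/4.\<close>

lemma trace_sketch_hits:
  assumes "m > 0" "finite I" "I \<noteq> {}" "I \<subseteq> {..<D}" "2 * D \<le> 2 ^ m"
  shows "1 / 4 \<le> card {xs. length xs = 2 * m \<and>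
    (\<Sum>i\<in>I. field_trace m (field_elem m (drop m xs) * field_elem m (take m xs) ^ i)) \<noteq> 0} / 2 ^ (2 * m)"
proof -
  let ?T = "{xs. length xs = 2 * m \<and>
    (\<Sum>i\<in>I. field_trace m (field_elem m (drop m xs) * field_elem m (take m xs) ^ i)) \<noteq> 0}"
  define y where "y ys = (\<Sum>i\<in>I. field_elem m ys ^ i)" for ys
  let ?G = "{ys. length ys = m \<and> y ys \<noteq> 0}"
  let ?H = "\<lambda>ys. {zs. length zs = m \<and> field_trace m (field_elem m zs * y ys) \<noteq> 0}"
  have pow: "(2 :: nat) ^ m = 2 * 2 ^ (m - 1)" using assms(1) by (cases m) auto
  note roots = card_sum_powers_zero[OF assms(2,3), of D, where 'a = "bit alg_closure"]
  have "2 ^ m - D \<le> card ?G" unfolding y_def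
    using card_field_elem_neq_0_ge[OF assms(1), of "\<lambda>x. \<Sum>i\<in>I. x ^ i" D] roots assms(4)
    by fastforce
  hence G: "2 ^ (m - 1) \<le> card ?G" using assms(5) pow by simp
  have H: "2 ^ (m - 1) \<le> card (?H ys)" if "ys \<in> ?G" for ys
    using card_field_elem_neq_0_ge[OF assms(1) card_field_trace_zero_le(2,1)[OF assms(1)], of "y ys"] that pow
    by simp
  have fin: "finite ?G" "finite (?H ys)" for ys
    by (rule finite_subset[OF _ finite_bool_lists[of m]]; blast)+
  have "2 ^ (m - 1) * 2 ^ (m - 1) \<le> card ?G * 2 ^ (m - 1)" using G by simp
  also have "\<dots> = (\<Sum>ys\<in>?G. 2 ^ (m - 1))" by simp
  also have "\<dots> \<le> (\<Sum>ys\<in>?G. card (?H ys))" by (rule sum_mono) (rule H)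
  also have "\<dots> = card (Sigma ?G ?H)" using fin by (subst card_SigmaI) auto
  also have "\<dots> \<le> card ?T"
  proof (rule card_inj_on_le)
    show "inj_on (\<lambda>(ys, zs). ys @ zs) (Sigma ?G ?H)" by (auto simp: inj_on_def)
    show "finite ?T" by (rule finite_subset[OF _ finite_bool_lists[of "2 * m"]]) blast
    show "(\<lambda>(ys, zs). ys @ zs) ` Sigma ?G ?H \<subseteq> ?T"
      \<comment> \<open>Additivity of the trace moves the sum over \<open>I\<close> inside
        it.\<close>
      by (auto simp: y_def sum_distrib_left field_trace_sum CHAR_bit)
  qed
  finally have le: "2 ^ (m - 1) * 2 ^ (m - 1) \<le> card ?T" .
  have "2 * m = 2 + (m - 1) + (m - 1)" using assms(1) by simp
  hence eq: "(2 :: real) ^ (2 * m) = 4 * real (2 ^ (m - 1) * 2 ^ (m - 1))"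
    by (simp only: power_add) simp
  have quarter: "1 / 4 \<le> real c / z" if "b \<le> c" "z = 4 * real b" "b > 0" for b c :: nat and z :: real
    using that by (simp add: field_simps)
  show ?thesis by (rule quarter[OF le eq]) simp
qed

lemma linear_sketch_powers:
  assumes "\<And>n. m n > 0"
  shows "linear_sketch m (\<lambda>n xs i. field_elem (m n) xs ^ i) (\<lambda>n. frobenius_fixed (m n))
    (\<lambda>n. inv_into {xs. length xs = m n} (field_elem (m n))) (\<lambda>n. field_elem (m n))"
proof
  fix n
  note bij = bij_betw_field_elem[OF assms[of n]]
  show "field_elem (m n) xs ^ i \<in> frobenius_fixed (m n)" if "length xs = m n" for xs i
    using bij_betwE[OF bij] that by (simp add: frobenius_fixed_power)
  show "field_elem (m n) (inv_into {xs. length xs = m n} (field_elem (m n)) b) = b"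
    if "b \<in> frobenius_fixed (m n)" for b
    by (rule bij_betw_inv_into_right[OF bij that])
qed (simp_all add: CHAR_bit frobenius_fixed_add)

lemma linear_sketch_trace:
  assumes "\<And>n. m n > 0"
  shows "linear_sketch (\<lambda>n. 2 * m n)
    (\<lambda>n xs i. field_trace (m n) (field_elem (m n) (drop (m n) xs) * field_elem (m n) (take (m n) xs) ^ i))
    (\<lambda>n. {0, 1}) (\<lambda>n b. [b = 1]) (\<lambda>n e. of_bool (e = [True]))"
proof
  fix n i and xs :: "bool list"
  assume "length xs = 2 * m n"
  hence "field_elem (m n) (drop (m n) xs) \<in> frobenius_fixed (m n)"
    "field_elem (m n) (take (m n) xs) \<in> frobenius_fixed (m n)"
    using bij_betwE[OF bij_betw_field_elem[OF assms[of n]]] by auto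
  thus "field_trace (m n) (field_elem (m n) (drop (m n) xs) * field_elem (m n) (take (m n) xs) ^ i) \<in> {0, 1}"
    by (intro field_trace_01 CHAR_closure frobenius_fixed_mult frobenius_fixed_power)
next
  have "(1 :: bit alg_closure) + 1 = of_nat 2" by simp
  also have "\<dots> = 0" by (metis CHAR_closure of_nat_CHAR)
  finally show "b + c \<in> {0, 1}" if "b \<in> {0, 1}" "c \<in> {0, 1}" for b c :: "bit alg_closure"
    using that by auto
qed (auto simp: CHAR_bit)

section \<open>Logarithmic message sizes\<close>

definition clog :: "nat \<Rightarrow> nat" where
  "clog n = nat \<lceil>log 2 n\<rceil>"

lemma le_power_clog: "n \<ge> 1 \<Longrightarrow> n \<le> 2 ^ clog n"
proof -
  assume n: "n \<ge> 1"
  hence "real n = 2 powr (log 2 n)" by simp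
  also have "\<dots> \<le> 2 powr (clog n)" unfolding clog_def by (intro powr_mono) linarith+
  finally have "real n \<le> real (2 ^ clog n)" by (simp add: powr_realpow)
  thus ?thesis by linarith
qed

text \<open>Rounding up adds at most 1, which is at most \<open>log 2 q\<close>; hence the factor
  2.\<close>

lemma clog_le:
  assumes "p \<ge> 1" "p \<le> q" "q \<ge> 2"
  shows "clog p \<le> 2 * log 2 q"
proof -
  have "0 \<le> log 2 p" "log 2 p \<le> log 2 q" "log 2 2 \<le> log 2 q"
    using assms by (simp_all only: log_le_cancel_iff zero_le_log_cancel_iff)
  thus ?thesis unfolding clog_def by simp linarith
qed

text \<open>The pairing function is quadratic, with values below \<open>8 * u ^ 2\<close>, so
  \<open>2 * clog u + 3\<close> bits suffice. With \<open>L = log 2 (n + u)\<close> at least 1, this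
  is at most \<open>4 * L + 3 * L\<close>.\<close>

lemma length_bin_prod_encode_le:
  assumes "j \<in> {1..u}" "k \<in> {1..u}" "n \<ge> 1"
  shows "length (bin (prod_encode (j, k))) \<le> 7 * log 2 (real (n + u))"
proof -
  have "triangle (j + k) \<le> (2 * u) * (2 * u + 1) div 2"
    unfolding triangle_def using assms by (intro div_le_mono mult_le_mono) auto
  also have "\<dots> = u * (2 * u + 1)" by (simp only: mult.assoc)
  finally have "prod_encode (j, k) \<le> u * (2 * u + 1) + u"
    using assms by (simp add: prod_encode_def)
  also have "\<dots> < 8 * (u * u)" using assms by (cases u) auto
  also have "\<dots> \<le> 8 * (2 ^ clog u * 2 ^ clog u)"
    using assms le_power_clog[of u] by (intro mult_le_mono) auto
  also have "\<dots> = 2 ^ (2 * clog u + 3)"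
    unfolding power_add mult_2 by (subst mult.commute) simp
  finally have "length (bin (prod_encode (j, k))) \<le> 2 * clog u + 3" by (rule length_bin_le)
  moreover have "clog u \<le> 2 * log 2 (real (n + u))" using assms by (intro clog_le) auto
  moreover have "log 2 2 \<le> log 2 (real (n + u))" using assms by (intro log_mono) auto
  ultimately show ?thesis by simp
qed

lemma (in linear_sketch) message_size_le_sketch_proc:
  fixes t :: real
  assumes "valid_network a u N" "x \<in> nodes N" "j \<in> {1..u}" "k \<in> {1..u}"
    and bcast: "s (card (nodes N)) + 7 * log 2 (real (card (nodes N) + u)) \<le> t"
    and echo: "\<And>b. b \<in> A (card (nodes N)) \<Longrightarrow> length (enc (card (nodes N)) b) \<le> t"
  shows "message_size_le t sketch_proc N x j k"
proof -
  have "card (nodes N) \<ge> 1"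
    using assms(2) valid_finite_nodes[OF assms(1)] by (auto simp: Suc_le_eq card_gt_0_iff)
  note bin = length_bin_prod_encode_le[OF assms(3,4) this]
  have "real (length m) \<le> t" if "bcast_sent N sketch_proc x (j, k) \<omega> v w m" for \<omega> v w m
    using length_bcast[OF assms(1,2) that] bin bcast by simp
  thus ?thesis
    using echo_in_range[OF assms(1,2)] echo unfolding message_size_le_def by blast
qed

section \<open>ID bounds and the size of the field\<close>

context
  fixes a :: real and d :: nat
begin

text \<open>Rounding \<open>a\<close> up to a natural number gives an integer power, and adding 1
  makes the bound on the IDs strict.\<close>

definition id_bound :: "nat \<Rightarrow> nat" where
  "id_bound n = n ^ nat \<lceil>a\<rceil> + 1"

text \<open>
  Chosen such that \<open>2 ^ field_deg n\<close> exceeds the number of edge codes by a factor of at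
  least \<open>2 * n ^ d\<close>.
\<close>

definition field_deg :: "nat \<Rightarrow> nat" where
  "field_deg n = 2 * (clog n * nat \<lceil>a\<rceil> + 1) + clog n * d + 1"

lemma nodes_less_id_bound:
  assumes "valid_network a u N"
  shows "nodes N \<subseteq> {..<id_bound (card (nodes N))}"
proof
  fix v assume v: "v \<in> nodes N"
  let ?n = "card (nodes N)"
  have "?n \<ge> 1" using v valid_finite_nodes[OF assms] by (auto simp: Suc_le_eq card_gt_0_iff)
  have "real v \<le> ?n powr a" by (rule valid_node_le[OF assms v])
  also have "\<dots> \<le> ?n powr (nat \<lceil>a\<rceil>)"
    using \<open>?n \<ge> 1\<close> by (intro powr_mono real_nat_ceiling_ge) simp
  also have "\<dots> = real (?n ^ nat \<lceil>a\<rceil>)" using \<open>?n \<ge> 1\<close> by (simp add: powr_realpow)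
  finally show "v \<in> {..<id_bound ?n}" by (simp add: id_bound_def)
qed

lemma id_bound_field_deg:
  assumes "n \<ge> 1"
  shows "2 * id_bound n ^ 2 * n ^ d \<le> 2 ^ field_deg n"
proof -
  have "n ^ nat \<lceil>a\<rceil> \<le> 2 ^ (clog n * nat \<lceil>a\<rceil>)"
    unfolding power_mult using le_power_clog[OF assms] by (rule power_mono) simp
  moreover have "(1 :: nat) \<le> 2 ^ (clog n * nat \<lceil>a\<rceil>)" by simp
  ultimately have "id_bound n \<le> 2 ^ (clog n * nat \<lceil>a\<rceil> + 1)"
    unfolding id_bound_def power_add power_one_right by linarith
  hence "id_bound n ^ 2 \<le> (2 ^ (clog n * nat \<lceil>a\<rceil> + 1)) ^ 2" by (rule power_mono) simp
  moreover have "n ^ d \<le> 2 ^ (clog n * d)"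
    unfolding power_mult using le_power_clog[OF assms] by (rule power_mono) simp
  ultimately have "2 * id_bound n ^ 2 * n ^ d \<le>
      2 * (2 ^ (clog n * nat \<lceil>a\<rceil> + 1)) ^ 2 * 2 ^ (clog n * d)"
    by (intro mult_le_mono) simp_all
  also have "\<dots> = 2 ^ field_deg n"
    by (simp add: field_deg_def power_add mult_ac flip: power_mult)
  finally show ?thesis .
qed

text \<open>The degree is \<open>clog n * (2 * nat \<lceil>a\<rceil> + d) + 3\<close>. The estimate
  \<open>clog_le\<close> doubles the first coefficient, and the 3 is absorbed because the logarithm
  is at least 1.\<close>

lemma field_deg_le:
  assumes "n \<ge> 1" "u \<ge> 1"
  shows "field_deg n \<le> (4 * nat \<lceil>a\<rceil> + 2 * d + 3) * log 2 (real (n + u))"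
proof -
  let ?L = "log 2 (real (n + u))"
  have "clog n \<le> 2 * ?L" using assms by (intro clog_le) auto
  hence "clog n * real (2 * nat \<lceil>a\<rceil> + d) \<le> 2 * ?L * real (2 * nat \<lceil>a\<rceil> + d)" by (rule mult_right_mono) simp
  moreover have "log 2 2 \<le> ?L" using assms by (intro log_mono) auto
  ultimately show ?thesis by (simp add: field_deg_def algebra_simps)
qed

end

theorem lemma1:
  shows "(\<exists>q>0. \<forall>a::real. \<exists>P C. \<forall>N u x j k.
            valid_network a u N \<and> x \<in> nodes N \<and> j \<in> {1..u} \<and> k \<in> {1..u} \<longrightarrow>
              performs_test_out q P N x j k \<and>
              message_size_le (C * log 2 (real (card (nodes N) + u))) P N x j k \<and>
              one_bit_echo P N x j k) \<and>
         (\<forall>(a::real) (c::real). \<exists>P C. \<forall>N u x j k.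
            valid_network a u N \<and> x \<in> nodes N \<and> j \<in> {1..u} \<and> k \<in> {1..u} \<longrightarrow>
              performs_test_out (1 - real (card (nodes N)) powr (- c)) P N x j k \<and>
              message_size_le (C * log 2 (real (card (nodes N) + u))) P N x j k)"
proof (intro conjI allI)
  show "\<exists>q>0. \<forall>a::real. \<exists>P C. \<forall>N u x j k.
      valid_network a u N \<and> x \<in> nodes N \<and> j \<in> {1..u} \<and> k \<in> {1..u} \<longrightarrow>
        performs_test_out q P N x j k \<and>
        message_size_le (C * log 2 (real (card (nodes N) + u))) P N x j k \<and>
        one_bit_echo P N x j k"
  proof (rule exI[of _ "1/4"], intro conjI allI)
    fix a :: real
    \<comment> \<open>For a constant success probability, \<open>d = 0\<close> suffices: the field
      has at least twice as many elements as the bound on the edge codes, as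
      \<open>trace_sketch_hits\<close> requires.\<close>
    define m where "m = field_deg a 0"
    have m: "m n > 0" for n by (simp add: m_def field_deg_def)
    interpret linear_sketch "id_bound a" "\<lambda>n. 2 * m n"
      "\<lambda>n xs i. field_trace (m n) (field_elem (m n) (drop (m n) xs) * field_elem (m n) (take (m n) xs) ^ i)"
      "\<lambda>n. {0, 1}" "\<lambda>n b. [b = 1]" "\<lambda>n e. of_bool (e = [True])"
      by (rule linear_sketch_trace[OF m])
    \<comment> \<open>The factor 2 accounts for the two field elements in the seed, the 7 for the
      code of \<open>(j, k)\<close>.\<close>
    let ?C = "2 * real (4 * nat \<lceil>a\<rceil> + 3) + 7"
    show "\<exists>P C. \<forall>N u x j k. valid_network a u N \<and> x \<in> nodes N \<and> j \<in> {1..u} \<and> k \<in> {1..u} \<longrightarrow>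
        performs_test_out (1/4) P N x j k \<and>
        message_size_le (C * log 2 (real (card (nodes N) + u))) P N x j k \<and>
        one_bit_echo P N x j k"
    proof (intro exI[of _ sketch_proc] exI[of _ ?C] allI impI, elim conjE, intro conjI)
      fix N u x j k
      assume *: "valid_network a u N" "x \<in> nodes N" "j \<in> {1..u}" "k \<in> {1..u}"
      let ?n = "card (nodes N)" and ?L = "log 2 (real (card (nodes N) + u))"
      have n: "?n \<ge> 1" using *(2) valid_finite_nodes[OF *(1)] by (auto simp: Suc_le_eq card_gt_0_iff)
      have L: "log 2 2 \<le> ?L" using n * by (intro log_mono) auto
      show "performs_test_out (1/4) sketch_proc N x j k"
        using id_bound_field_deg[OF n, of a 0]
        by (intro performs_test_out_sketch_proc[OF *(1,2) nodes_less_id_bound[OF *(1)]]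
            trace_sketch_hits[OF m]) (simp_all add: m_def)
      have "m ?n \<le> (4 * nat \<lceil>a\<rceil> + 3) * ?L"
        using field_deg_le[of ?n u a 0] n * by (simp add: m_def)
      thus "message_size_le (?C * ?L) sketch_proc N x j k"
        using L by (intro message_size_le_sketch_proc[OF *]) (auto simp: algebra_simps)
      show "one_bit_echo sketch_proc N x j k"
        using echo_in_range[OF *(1,2)] unfolding one_bit_echo_def by fastforce
    qed
  qed simp
next
  fix a c :: real
  define d where "d = nat \<lceil>c\<rceil>"
  define m where "m = field_deg a d"
  have m: "m n > 0" for n by (simp add: m_def field_deg_def)
  interpret linear_sketch "id_bound a" m "\<lambda>n xs i. field_elem (m n) xs ^ i"
    "\<lambda>n. frobenius_fixed (m n)" "\<lambda>n. inv_into {xs. length xs = m n} (field_elem (m n))"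
    "\<lambda>n. field_elem (m n)"
    by (rule linear_sketch_powers[OF m])
  let ?C = "real (4 * nat \<lceil>a\<rceil> + 2 * d + 3) + 7"
  show "\<exists>P C. \<forall>N u x j k. valid_network a u N \<and> x \<in> nodes N \<and> j \<in> {1..u} \<and> k \<in> {1..u} \<longrightarrow>
      performs_test_out (1 - real (card (nodes N)) powr (- c)) P N x j k \<and>
      message_size_le (C * log 2 (real (card (nodes N) + u))) P N x j k"
  proof (intro exI[of _ sketch_proc] exI[of _ ?C] allI impI, elim conjE, intro conjI)
    fix N u x j k
    assume *: "valid_network a u N" "x \<in> nodes N" "j \<in> {1..u}" "k \<in> {1..u}"
    let ?n = "card (nodes N)" and ?L = "log 2 (real (card (nodes N) + u))"
    have n: "?n \<ge> 1" using *(2) valid_finite_nodes[OF *(1)] by (auto simp: Suc_le_eq card_gt_0_iff)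
    have "2 * id_bound a ?n ^ 2 * ?n ^ d \<le> 2 ^ m ?n"
      unfolding m_def by (rule id_bound_field_deg[OF n])
    hence "id_bound a ?n ^ 2 * ?n ^ d \<le> 2 ^ m ?n" by linarith
    hence "real (id_bound a ?n ^ 2 * ?n ^ d) \<le> real (2 ^ m ?n)" by (rule of_nat_mono)
    \<comment> \<open>The left side is the failure bound from \<open>power_sketch_hits\<close>; the
      factor \<open>n ^ d\<close> built into the field size brings it below
      \<open>n powr (- c)\<close>, as \<open>d\<close> is at least \<open>c\<close>.\<close>
    hence "real (id_bound a ?n ^ 2) / 2 ^ m ?n \<le> 1 / real ?n ^ d"
      using n by (simp add: field_simps)
    also have "\<dots> = ?n powr (- real d)" using n by (simp add: powr_minus powr_realpow divide_inverse)
    also have "\<dots> \<le> ?n powr (- c)"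
      using n real_nat_ceiling_ge[of c] by (intro powr_mono) (simp_all add: d_def)
    finally have "1 - ?n powr (- c) \<le> 1 - real (id_bound a ?n ^ 2) / 2 ^ m ?n" by simp
    thus "performs_test_out (1 - ?n powr (- c)) sketch_proc N x j k"
      by (intro performs_test_out_sketch_proc[OF *(1,2) nodes_less_id_bound[OF *(1)]]
          order_trans[OF _ power_sketch_hits[OF m]])
    have "m ?n \<le> (4 * nat \<lceil>a\<rceil> + 2 * d + 3) * ?L"
      using field_deg_le[of ?n u a d] n * by (simp add: m_def)
    moreover have "0 \<le> ?L" using n by simp
    moreover have "length (inv_into {xs. length xs = m ?n} (field_elem (m ?n)) b) = m ?n"
      if "b \<in> frobenius_fixed (m ?n)" for b
      using inv_into_into[of b "field_elem (m ?n)" "{xs. length xs = m ?n}"] that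
        bij_betw_imp_surj_on[OF bij_betw_field_elem[OF m]] by auto
    ultimately show "message_size_le (?C * ?L) sketch_proc N x j k"
      by (intro message_size_le_sketch_proc[OF *]) (auto simp: algebra_simps)
  qed
qed

end
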